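(* Let $\Gamma\subset\mathbb{R}^d$ be an acute closed convex solid cone. The inverse $\psi:\operatorname{CM}_H(\Gamma\times\mathbb{R}_+)\to\widetilde{\operatorname{CM}}(\Gamma)$ of the Borel transform $\mathcal{B}$ is given by $$\psi(\Phi)(p)=\lim_{T\to\infty}\frac{1}{2\pi i}\int_{\gamma-iT}^{\gamma+iT}\widetilde{\Phi}_p(z)\,e^z\,dz\qquad\text{for all }p\in\operatorname{int}\Gamma,$$ where $\gamma$ is any positive real number, and where $\Phi\in\operatorname{CM}_H(\Gamma\times\mathbb{R}_+)$ is the Stieltjes–Fantappiè transform of $\mu\in\mathcal{M}^+(\Gamma^* )$ and $$\widetilde{\Phi}_p(z)=\int_{\Gamma^*}\frac{d\mu(x)}{z+p\cdot x},\qquad \operatorname{Re}z>0 .$$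
   Context: Acute means containing no line; solid means with non-empty interior. $\Gamma^*=\{y\in\mathbb{R}^d: y\cdot x\ge 0\ \forall x\in\Gamma\}$; $\mathbb{R}_+=(0,\infty)$. $\mathcal{M}^+(\Gamma^* )$ is the set of finite non-negative measures supported on $\Gamma^*$. A real function $f$ on the interior of a closed convex cone $C$ is completely monotone if it is $C^\infty$ there and $(-1)^kD_{\xi^{(1)}}\cdots D_{\xi^{(k)}}f(p)\ge0$ for all $k\ge 0$, all interior points $p$, and all $\xi^{(1)},\dots,\xi^{(k)}\in C$, where $D_\xi=\sum_j\xi_j\partial/\partial p_j$. $\widetilde{\operatorname{CM}}(\Gamma)$: continuous functions on $\Gamma$ that are completely monotone on $\operatorname{int}\Gamma$. $\operatorname{CM}_H(\Gamma\times\mathbb{R}_+)$: functions that are completely monotone on $\operatorname{int}\Gamma\times\mathbb{R}_+$, continuous on $\Gamma\times\mathbb{R}_+$, and homogeneous of degree $-1$. The Borel transform $\mathcal{B}:\widetilde{\operatorname{CM}}(\Gamma)\to\operatorname{CM}_H(\Gamma\times\mathbb{R}_+)$ is $\mathcal{B}(F)(p,p_0)=\int_0^\infty F(tp)e^{-tp_0}\,dt$, $p\in\Gamma$, $p_0>0$. The Stieltjes–Fantappiè transform of $\mu\in\mathcal{M}^+(\Gamma^* )$ is $\Phi(p,p_0)=\int_{\Gamma^*}\frac{d\mu(x)}{p_0+p\cdot x}$. Known facts (Bernstein–Bochner–Gilbert, Henkin–Shananin): $\widetilde{\operatorname{CM}}(\Gamma)$ consists exactly of the Laplace transforms $F(p)=\int_{\Gamma^*}e^{-p\cdot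 x}d\mu(x)$ of $\mu\in\mathcal{M}^+(\Gamma^* )$, $\operatorname{CM}_H(\Gamma\times\mathbb{R}_+)$ consists exactly of the Stieltjes–Fantappiè transforms of $\mu\in\mathcal{M}^+(\Gamma^* )$, and $\mathcal{B}$ is a bijection carrying the Laplace transform of $\mu$ to its Stieltjes–Fantappiè transform. *)

theory Defs
  imports "HOL-Complex_Analysis.Complex_Analysis"
begin

definition acute :: "'a::real_vector set \<Rightarrow> bool" where
  "acute C \<longleftrightarrow> \<not> (\<exists>a v. v \<noteq> 0 \<and> range (\<lambda>t::real. a + t *\<^sub>R v) \<subseteq> C)"

definition dual_cone :: "'a::real_inner set \<Rightarrow> 'a set" where
  "dual_cone C = {y. \<forall>x\<in>C. 0 \<le> y \<bullet> x}"

text \<open>As the dual cone is closed, a Borel measure is supported on it iff the complement is a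
  null set.\<close>

definition finite_measures_on_dual :: "'a::euclidean_space set \<Rightarrow> 'a measure set" where
  "finite_measures_on_dual C =
     {\<mu>. sets \<mu> = sets borel \<and> finite_measure \<mu> \<and> emeasure \<mu> (- dual_cone C) = 0}"

definition dir_deriv :: "'a::euclidean_space \<Rightarrow> ('a \<Rightarrow> real) \<Rightarrow> 'a \<Rightarrow> real" where
  "dir_deriv \<xi> f p = (\<Sum>j\<in>Basis. (\<xi> \<bullet> j) * frechet_derivative f (at p) j)"

text \<open>\<open>Ck_on k f S\<close> is meant for open \<open>S\<close>: \<open>f\<close> is \<open>k\<close> times continuously differentiable on \<open>S\<close>.\<close>

primrec Ck_on :: "nat \<Rightarrow> ('a::euclidean_space \<Rightarrow> real) \<Rightarrow> 'a set \<Rightarrow> bool" where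
  "Ck_on 0 f S \<longleftrightarrow> continuous_on S f"
| "Ck_on (Suc k) f S \<longleftrightarrow> (\<forall>p\<in>S. f differentiable (at p)) \<and>
     (\<forall>j\<in>Basis. Ck_on k (\<lambda>p. frechet_derivative f (at p) j) S)"

text \<open>The list \<open>[\<xi>\<^sub>1, \<dots>, \<xi>\<^sub>k]\<close> stands for the operator \<open>D\<^bsub>\<xi>\<^sub>1\<^esub> \<dots> D\<^bsub>\<xi>\<^sub>k\<^esub>\<close>.  The values of \<open>f\<close> outside
  the interior of \<open>C\<close> play no role.\<close>

definition completely_monotone :: "'a::euclidean_space set \<Rightarrow> ('a \<Rightarrow> real) \<Rightarrow> bool" where
  "completely_monotone C f \<longleftrightarrow>
     (\<forall>k. Ck_on k f (interior C)) \<and>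
     (\<forall>\<xi>s. set \<xi>s \<subseteq> C \<longrightarrow>
        (\<forall>p\<in>interior C. 0 \<le> (- 1) ^ length \<xi>s * foldr dir_deriv \<xi>s f p))"

text \<open>Functions on \<open>\<Gamma>\<close> and on \<open>\<Gamma> \<times> (0, \<infinity>)\<close> are represented by extensional total functions, so that
  equality of functions on the domain is equality in HOL and the inverse of the Borel transform
  is an honest inverse.\<close>

definition CM_tilde :: "'a::euclidean_space set \<Rightarrow> ('a \<Rightarrow> real) set" where
  "CM_tilde \<Gamma> = {F \<in> extensional \<Gamma>. continuous_on \<Gamma> F \<and> completely_monotone \<Gamma> F}"

text \<open>The interior of the closed cone \<open>\<Gamma> \<times> {0..}\<close> is \<open>interior \<Gamma> \<times> {0<..}\<close>.\<close>

definition CM_H :: "'a::euclidean_space set \<Rightarrow> ('a \<times> real \<Rightarrow> real) set" where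
  "CM_H \<Gamma> = {\<Phi> \<in> extensional (\<Gamma> \<times> {0<..}).
     continuous_on (\<Gamma> \<times> {0<..}) \<Phi> \<and>
     completely_monotone (\<Gamma> \<times> {0..}) \<Phi> \<and>
     (\<forall>p\<in>\<Gamma>. \<forall>p0>0. \<forall>c>0. \<Phi> (c *\<^sub>R p, c * p0) = inverse c * \<Phi> (p, p0))}"

definition borel_transform ::
    "'a::euclidean_space set \<Rightarrow> ('a \<Rightarrow> real) \<Rightarrow> ('a \<times> real \<Rightarrow> real)" where
  "borel_transform \<Gamma> F =
     (\<lambda>(p, p0)\<in>\<Gamma> \<times> {0<..}. LBINT t:{0..}. F (t *\<^sub>R p) * exp (- t * p0))"

definition stieltjes_fantappie ::
    "'a::euclidean_space set \<Rightarrow> 'a measure \<Rightarrow> ('a \<times> real \<Rightarrow> real)" where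
  "stieltjes_fantappie \<Gamma> \<mu> =
     (\<lambda>(p, p0)\<in>\<Gamma> \<times> {0<..}. LINT x:dual_cone \<Gamma>|\<mu>. 1 / (p0 + p \<bullet> x))"

definition stieltjes_extension ::
    "'a::euclidean_space set \<Rightarrow> 'a measure \<Rightarrow> 'a \<Rightarrow> complex \<Rightarrow> complex" where
  "stieltjes_extension \<Gamma> \<mu> p z = (LINT x:dual_cone \<Gamma>|\<mu>. 1 / (z + of_real (p \<bullet> x)))"

definition inverse_borel ::
    "'a::euclidean_space set \<Rightarrow> ('a \<times> real \<Rightarrow> real) \<Rightarrow> ('a \<Rightarrow> real)" where
  "inverse_borel \<Gamma> = inv_into (CM_tilde \<Gamma>) (borel_transform \<Gamma>)"

end

theory Submission
  imports Defs
begin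

text \<open>The preimage of \<open>\<Phi>\<close> under the Borel transform is the Laplace transform of \<open>\<mu>\<close>.  It lies in
  \<open>CM_tilde \<Gamma>\<close> because its iterated directional derivatives are obtained under the integral sign: for
  \<open>p\<close> in the interior of \<open>\<Gamma>\<close> one has \<open>p \<bullet> x \<ge> \<epsilon> * norm x\<close> on the dual cone, which dominates every
  polynomial factor.  Its Borel transform is computed by Fubini.  It is the only preimage, since a
  function in \<open>CM_tilde \<Gamma>\<close> decreases along rays inside \<open>\<Gamma>\<close>, so that Lerch's theorem applies on each
  ray; no representation theorem of Bernstein type is needed.

  The Bromwich integral is reduced by Fubini to \<open>exp z / (z + a)\<close> with \<open>a = p \<bullet> x \<ge> 0\<close>.  Closing the
  vertical segment by a rectangle around the pole \<open>- a\<close> whose left side tends to infinity shows that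
  the truncated integral differs from \<open>exp (- a)\<close> by at most \<open>exp \<gamma> / (pi * T)\<close>.  This is uniform in
  \<open>a\<close>, so it can be integrated against the finite measure \<open>\<mu>\<close>.\<close>

subsection \<open>The truncated Bromwich integral of an exponential\<close>

text \<open>The majorant \<open>K * exp x\<close> is integrated along the segment instead of being
  multiplied by its length. The bound never exceeds \<open>K * exp b\<close>, so it survives moving
  the left end point to -\<infinity>.\<close>

lemma contour_integral_horizontal_bound:
  fixes f :: "complex \<Rightarrow> complex"
  assumes int: "(f has_contour_integral I) (linepath (Complex a s) (Complex b s))"
    and "a \<le> b" and le: "\<And>x. x \<in> {a..b} \<Longrightarrow> norm (f (Complex x s)) \<le> K * exp x"
  shows "norm I \<le> K * (exp b - exp a)"
proof -
  have 1: "((\<lambda>t. f (linepath (Complex a s) (Complex b s) t) * (Complex b s - Complex a s)) has_integral I) {0..1}"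
    using int by (simp add: has_contour_integral_linepath)
  have 2: "((\<lambda>t. K * exp (a + t * (b - a)) * (b - a)) has_integral
      (K * exp (a + 1 * (b - a)) - K * exp (a + 0 * (b - a)))) {0..1}"
    by (intro fundamental_theorem_of_calculus)
       (auto intro!: derivative_eq_intros simp flip: has_real_derivative_iff_has_vector_derivative)
  have "norm I \<le> K * exp (a + 1 * (b - a)) - K * exp (a + 0 * (b - a))"
    unfolding integral_unique[OF 1, symmetric] integral_unique[OF 2, symmetric]
  proof (rule Henstock_Kurzweil_Integration.integral_norm_bound_integral)
    show "(\<lambda>t. f (linepath (Complex a s) (Complex b s) t) * (Complex b s - Complex a s)) integrable_on {0..1}"
      using 1 by blast
    show "(\<lambda>t. K * exp (a + t * (b - a)) * (b - a)) integrable_on {0..1}" using 2 by blast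
    fix t :: real assume t: "t \<in> {0..1}"
    have eq: "linepath (Complex a s) (Complex b s) t = Complex (a + t * (b - a)) s"
      by (simp add: linepath_def complex_eq_iff algebra_simps)
    have "a + t * (b - a) \<le> a + 1 * (b - a)"
      using t \<open>a \<le> b\<close> by (intro add_left_mono mult_right_mono) auto
    then have "a + t * (b - a) \<in> {a..b}" using t \<open>a \<le> b\<close> by auto
    from le[OF this] have "norm (f (Complex (a + t * (b - a)) s)) * (b - a) \<le> K * exp (a + t * (b - a)) * (b - a)"
      using \<open>a \<le> b\<close> by (intro mult_right_mono) auto
    moreover have "norm (Complex b s - Complex a s) = b - a"
      using \<open>a \<le> b\<close> by (simp add: cmod_def)
    ultimately show "norm (f (linepath (Complex a s) (Complex b s) t) * (Complex b s - Complex a s))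
        \<le> K * exp (a + t * (b - a)) * (b - a)"
      by (simp add: eq norm_mult)
  qed
  then show ?thesis by (simp add: algebra_simps)
qed

text \<open>On the horizontal edges \<open>z + a\<close> has modulus at least \<open>T\<close>, so
  each costs at most \<open>exp \<gamma> / T\<close>. The left edge has length \<open>2 * T\<close>
  and, by \<open>a + 1 \<le> R\<close>, keeps distance at least 1 from the pole, so it costs at most
  \<open>exp (- R) * (2 * T)\<close>.\<close>

lemma rectangle_vertical_bound:
  fixes a \<gamma> T R :: real
  assumes "0 \<le> a" "0 < \<gamma>" "0 < T" "a + 1 \<le> R"
  shows "norm (contour_integral (linepath (Complex \<gamma> (- T)) (Complex \<gamma> T))
      (\<lambda>z. exp z / (z + of_real a)) - 2 * of_real pi * \<i> * of_real (exp (- a)))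
    \<le> 2 * exp \<gamma> / T + exp (- R) * (2 * T)"
proof -
  let ?f = "\<lambda>z::complex. exp z / (z + of_real a)"
  define b where "b = Complex (-R) (-T)"
  define c where "c = Complex \<gamma> T"
  have a_in: "- complex_of_real a \<in> box b c"
    using assms by (auto simp: in_box_complex_iff b_def c_def)
  \<comment> \<open>The residue at \<open>- a\<close> comes from Cauchy's formula for the entire
    function \<open>exp\<close>; the rectangle winds around the pole once.\<close>
  have "((\<lambda>w. exp w / (w - (- of_real a))) has_contour_integral
      (2 * pi * \<i> * winding_number (rectpath b c) (- of_real a) * exp (- of_real a))) (rectpath b c)"
  proof (rule Cauchy_integral_formula_convex_simple[where S = UNIV])
    show "path_image (rectpath b c) \<subseteq> UNIV - {- complex_of_real a}"
      using a_in assms by (subst path_image_rectpath_cbox_minus_box) (auto simp: b_def c_def)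
  qed (auto intro!: holomorphic_intros)
  then have rect: "(?f has_contour_integral (2 * pi * \<i> * exp (- of_real a))) (rectpath b c)"
    using winding_number_rectpath[OF a_in] by simp
  have nz: "norm (z + of_real a) \<ge> T" if "\<bar>Im z\<bar> = T" for z
    using that abs_Im_le_cmod[of "z + of_real a"] by simp
  have nz2: "norm (z + of_real a) \<ge> 1" if "Re z = -R" for z
    using that assms abs_Re_le_cmod[of "z + of_real a"] by simp
  define I1 where "I1 = contour_integral (linepath (Complex (-R) (-T)) (Complex \<gamma> (-T))) ?f"
  define I2 where "I2 = contour_integral (linepath (Complex \<gamma> (-T)) (Complex \<gamma> T)) ?f"
  define I3 where "I3 = contour_integral (linepath (Complex \<gamma> T) (Complex (-R) T)) ?f"
  define I4 where "I4 = contour_integral (linepath (Complex (-R) T) (Complex (-R) (-T))) ?f"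
  have ints: "?f contour_integrable_on linepath (Complex (-R) (-T)) (Complex \<gamma> (-T))"
     "?f contour_integrable_on linepath (Complex \<gamma> (-T)) (Complex \<gamma> T)"
     "?f contour_integrable_on linepath (Complex \<gamma> T) (Complex (-R) T)"
     "?f contour_integrable_on linepath (Complex (-R) T) (Complex (-R) (-T))"
    using has_contour_integral_integrable[OF rect]
    by (auto simp: rectpath_def Let_def b_def c_def)
  have "contour_integral (rectpath b c) ?f = I1 + (I2 + (I3 + I4))"
    using ints by (simp add: rectpath_def Let_def b_def c_def I1_def I2_def I3_def I4_def)
  then have sum: "I1 + (I2 + (I3 + I4)) = 2 * of_real pi * \<i> * of_real (exp (- a))"
    using contour_integral_unique[OF rect] by (simp flip: exp_of_real)
  have hor: "norm (?f (Complex x s)) \<le> 1 / T * exp x" if "\<bar>s\<bar> = T" for x s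
  proof -
    have "norm (?f (Complex x s)) = exp x / norm (Complex x s + of_real a)"
      by (simp add: norm_divide norm_exp_eq_Re)
    also have "\<dots> \<le> exp x / T"
      using nz[of "Complex x s"] that assms by (intro divide_left_mono mult_pos_pos) auto
    finally show ?thesis by simp
  qed
  have "norm I1 \<le> 1 / T * (exp \<gamma> - exp (-R))"
    unfolding I1_def
    by (rule contour_integral_horizontal_bound[OF has_contour_integral_integral[OF ints(1)]])
       (use assms hor in auto)
  \<comment> \<open>\<open>I3\<close> runs from right to left; its negative has the orientation that
    the horizontal estimate expects.\<close>
  moreover have "norm (- I3) \<le> 1 / T * (exp \<gamma> - exp (-R))"
    unfolding I3_def
    by (rule contour_integral_horizontal_bound[OF has_contour_integral_reverse_linepath
          [OF has_contour_integral_integral[OF ints(3)]]])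
       (use assms hor in auto)
  moreover have "1 / T * (exp \<gamma> - exp (-R)) \<le> exp \<gamma> / T"
    using assms by (simp add: field_simps)
  moreover have "norm I4 \<le> exp (-R) * norm (Complex (-R) (-T) - Complex (-R) T)"
    unfolding I4_def
  proof (rule contour_integral_bound_linepath[OF ints(4)])
    fix z assume z: "z \<in> closed_segment (Complex (- R) T) (Complex (- R) (- T))"
    then have "Re z = -R" by (auto simp: closed_segment_same_Re)
    with nz2[OF this] show "norm (?f z) \<le> exp (-R)"
      using frac_le[of "exp (- R)" "exp (- R)" 1 "norm (z + of_real a)"]
      by (simp add: norm_divide norm_exp_eq_Re \<open>Re z = -R\<close>)
  qed auto
  moreover have "norm (Complex (-R) (-T) - Complex (-R) T) = 2 * T"
    using assms by (simp add: cmod_def real_sqrt_mult)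
  moreover have "I2 - 2 * of_real pi * \<i> * of_real (exp (- a)) = - I1 - I3 - I4"
    using sum by (simp add: algebra_simps)
  moreover have "norm (- I1 - I3 - I4) \<le> norm I1 + norm I3 + norm I4"
    by (smt (verit) norm_minus_cancel norm_triangle_ineq4)
  ultimately show ?thesis
    unfolding I2_def[symmetric] by simp
qed

text \<open>The left-hand side does not involve \<open>R\<close>, so the rectangle estimate passes
  to the limit of large \<open>R\<close>. Which \<open>R\<close> are admissible depends on
  \<open>a\<close>, but the limiting bound does not.\<close>

lemma Bromwich_exp_bound:
  fixes a \<gamma> T :: real
  assumes "0 \<le> a" "0 < \<gamma>" "0 < T"
  shows "norm (contour_integral (linepath (Complex \<gamma> (- T)) (Complex \<gamma> T))
      (\<lambda>z. exp z / (z + of_real a)) - 2 * of_real pi * \<i> * of_real (exp (- a)))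
    \<le> 2 * exp \<gamma> / T"
proof (rule tendsto_lowerbound)
  show "((\<lambda>R. 2 * exp \<gamma> / T + exp (- R) * (2 * T)) \<longlongrightarrow> 2 * exp \<gamma> / T) at_top"
    by real_asymp
  show "\<forall>\<^sub>F R in at_top. norm (contour_integral (linepath (Complex \<gamma> (- T)) (Complex \<gamma> T))
      (\<lambda>z. exp z / (z + of_real a)) - 2 * of_real pi * \<i> * of_real (exp (- a)))
    \<le> 2 * exp \<gamma> / T + exp (- R) * (2 * T)"
    using eventually_ge_at_top[of "a + 1"]
    by eventually_elim (rule rectangle_vertical_bound[OF assms])
qed auto

subsection \<open>Uniqueness for the Laplace transform\<close>

lemma has_bochner_integral_exp_Ici:
  fixes a :: real
  assumes "0 < a"
  shows "has_bochner_integral lborel (\<lambda>t. indicator {0..} t * exp (- a * t)) (1 / a)"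
proof (rule has_bochner_integral_nn_integral)
  have "((\<lambda>t. exp (- a * t)) has_integral 1 / a) {0..}"
    using has_integral_exp_minus_to_infinity[OF assms, of 0] by simp
  then have "((\<lambda>t. indicator {0..} t * exp (- a * t)) has_integral 1 / a) UNIV"
    by (subst (asm) has_integral_restrict_UNIV[symmetric])
       (simp add: indicator_def of_bool_def if_distrib[of "\<lambda>x. x * _"] cong: if_cong)
  from nn_integral_has_integral_lborel[OF _ _ this]
  show "(\<integral>\<^sup>+ t. ennreal (indicator {0..} t * exp (- a * t)) \<partial>lborel) = ennreal (1 / a)"
    by simp
qed (use assms in auto)

text \<open>With \<open>u = exp (- t)\<close> the hypothesis kills all polynomials in \<open>u\<close> without
  constant term, and \<open>g\<close> times \<open>u\<close> is a continuous function of \<open>u\<close> on \<open>{0..1}\<close>, to which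
  Weierstrass' theorem applies.\<close>

lemma Lerch_uniqueness:
  fixes g :: "real \<Rightarrow> real"
  assumes cont: "continuous_on {0..} g"
    and bdd: "\<And>t. 0 \<le> t \<Longrightarrow> \<bar>g t\<bar> \<le> K"
    and zero: "\<And>n::nat. 0 < n \<Longrightarrow> (LINT t:{0..}|lborel. g t * exp (- t * real n)) = 0"
    and "0 \<le> t0"
  shows "g t0 = 0"
proof -
  \<comment> \<open>In the variable \<open>u = exp (- t)\<close> this is \<open>g\<close> times
    \<open>u\<close>. The value 0 at the origin is the limit from the right because \<open>g\<close>
    is bounded.\<close>
  define \<phi> where "\<phi> u = (if u \<le> 0 then 0 else u * g (- ln u))" for u
  have K0: "0 \<le> K" using bdd[of 0] by simp
  have \<phi>_exp: "\<phi> (exp (- t)) = g t * exp (- t)" for t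
    by (simp add: \<phi>_def)
  have \<phi>_le: "\<bar>\<phi> u\<bar> \<le> K * \<bar>u\<bar>" if "u \<in> {0..1}" for u
    using that bdd[of "- ln u"] K0 by (auto simp: \<phi>_def abs_mult mult.commute[of K] intro!: mult_left_mono)
  have cont_\<phi>: "continuous_on {0..1} \<phi>"
    unfolding continuous_on_eq_continuous_within
  proof
    fix u :: real assume u: "u \<in> {0..1}"
    show "continuous (at u within {0..1}) \<phi>"
    proof (cases "u = 0")
      case True
      have "(\<phi> \<longlongrightarrow> 0) (at 0 within {0..1})"
      proof (rule Lim_null_comparison)
        show "\<forall>\<^sub>F u in at 0 within {0..1}. norm (\<phi> u) \<le> K * \<bar>u\<bar>"
          using \<phi>_le by (auto simp: eventually_at_filter)
        show "((\<lambda>u. K * \<bar>u\<bar>) \<longlongrightarrow> 0) (at 0 within {0..1})"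
          by (auto intro!: tendsto_eq_intros)
      qed
      then show ?thesis by (simp add: True continuous_within \<phi>_def)
    next
      case False
      have "continuous_on {0<..1} (\<lambda>u. u * g (- ln u))"
        by (intro continuous_intros continuous_on_compose2[OF cont]) auto
      then have "continuous_on {0<..1} \<phi>"
        by (rule continuous_on_eq) (simp add: \<phi>_def)
      then have "continuous (at u within {0<..1}) \<phi>"
        using u False by (simp add: continuous_on_eq_continuous_within)
      moreover have "at u within {0<..1} = at u within {0..1}"
        by (rule at_within_nhd[of _ "{0<..}"]) (use u False in auto)
      ultimately show ?thesis by (simp add: continuous_within)
    qed
  qed
  \<comment> \<open>For \<open>t \<ge> 0\<close> this is \<open>\<phi> (exp (- t))\<close>. It is
    dominated by a multiple of \<open>exp (- t)\<close>, so its products with bounded measurable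
    functions of \<open>exp (- t)\<close> are integrable.\<close>
  define w where "w t = indicator {0..} t * g t * exp (- t)" for t :: real
  have [measurable]: "(\<lambda>t. indicator {0..} t * g t) \<in> borel_measurable borel"
    using borel_measurable_continuous_on_indicator[OF _ cont] by simp
  have w_meas[measurable]: "w \<in> borel_measurable borel" unfolding w_def by measurable
  have exp_int: "integrable lborel (\<lambda>t::real. indicat_real {0..} t * exp (- t))"
    using has_bochner_integral_exp_Ici[of 1] by (auto simp: has_bochner_integral_iff)
  have exp_eq: "(\<integral>t. indicat_real {0..} t * exp (- t) \<partial>lborel) = 1"
    using has_bochner_integral_exp_Ici[of 1] by (auto simp: has_bochner_integral_iff)
  have w_le: "\<bar>w t\<bar> \<le> K * (indicator {0..} t * exp (- t))" for t
    using bdd[of t] by (auto simp: w_def abs_mult indicator_def)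
  have int_bd: "integrable lborel (\<lambda>t. w t * h (exp (- t)))"
    if [measurable]: "h \<in> borel_measurable borel" and h: "\<And>u. u \<in> {0..1} \<Longrightarrow> \<bar>h u\<bar> \<le> M" for h M
  proof (rule Bochner_Integration.integrable_bound)
    show "integrable lborel (\<lambda>t. (K * M) * (indicator {0..} t * exp (- t)))"
      by (intro integrable_mult_right exp_int)
    have "\<bar>w t * h (exp (- t))\<bar> \<le> (K * M) * (indicator {0..} t * exp (- t))" for t
    proof (cases "0 \<le> t")
      case True
      then have "\<bar>h (exp (- t))\<bar> \<le> M" by (intro h) auto
      with w_le[of t] have "\<bar>w t\<bar> * \<bar>h (exp (- t))\<bar> \<le> (K * (indicator {0..} t * exp (- t))) * M"
        using K0 by (intro mult_mono) auto
      then show ?thesis by (simp add: abs_mult ac_simps)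
    qed (simp add: w_def)
    then show "AE t in lborel. norm (w t * h (exp (- t))) \<le> norm ((K * M) * (indicator {0..} t * exp (- t)))"
      by (intro AE_I2) (smt (verit) real_norm_def)
  qed measurable
  have mono_int: "integrable lborel (\<lambda>t. w t * exp (- t) ^ n)" for n
    by (rule int_bd[of "\<lambda>u. u ^ n" 1]) (auto simp: power_abs abs_of_nonneg intro!: power_le_one)
  \<comment> \<open>The factor \<open>exp (- t)\<close> inside \<open>w\<close> shifts the exponent
    by one: the hypothesis at \<open>Suc n\<close> kills the monomial of degree \<open>n\<close>, so
    the constant polynomial is included.\<close>
  have mono_zero: "(\<integral>t. w t * exp (- t) ^ n \<partial>lborel) = 0" for n
  proof -
    have "w t * exp (- t) ^ n = indicator {0..} t *\<^sub>R (g t * exp (- t * real (Suc n)))" for t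
      by (simp add: w_def exp_of_nat2_mult[symmetric] algebra_simps flip: exp_add)
    then show ?thesis using zero[of "Suc n"] by (simp add: set_lebesgue_integral_def)
  qed
  have sq_int: "integrable lborel (\<lambda>t. (w t)\<^sup>2)"
  proof -
    \<comment> \<open>Cutting \<open>\<phi>\<close> off outside \<open>{0..1}\<close> gives a
      measurable multiplier bounded by \<open>K\<close>. The cut-off changes nothing for
      \<open>t \<ge> 0\<close>, and \<open>w\<close> vanishes for \<open>t < 0\<close>.\<close>
    have "integrable lborel (\<lambda>t. w t * (indicator {0..1} (exp (- t)) * \<phi> (exp (- t))))"
    proof (rule int_bd[of "\<lambda>u. indicator {0..1} u * \<phi> u" K])
      show "(\<lambda>u. indicator {0..1} u * \<phi> u) \<in> borel_measurable borel"
        using borel_measurable_continuous_on_indicator[OF _ cont_\<phi>] by simp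
      show "\<bar>indicator {0..1} u * \<phi> u\<bar> \<le> K" if "u \<in> {0..1}" for u
      proof -
        have "K * \<bar>u\<bar> \<le> K * 1" using that K0 by (intro mult_left_mono) auto
        with \<phi>_le[OF that] that show ?thesis by simp
      qed
    qed
    moreover have "w t * (indicator {0..1} (exp (- t)) * \<phi> (exp (- t))) = (w t)\<^sup>2" for t
      by (auto simp: \<phi>_exp w_def power2_eq_square indicator_def)
    ultimately show ?thesis by simp
  qed
  \<comment> \<open>\<open>w\<close> is orthogonal to all polynomials in \<open>exp (- t)\<close>,
    so subtracting a Weierstrass approximation \<open>P\<close> of \<open>\<phi>\<close> does not
    change the integral. What remains is at most \<open>e\<close> times the integral of
    \<open>\<bar>w\<bar>\<close>, which is at most \<open>K\<close>.\<close>
  have small: "(\<integral>t. (w t)\<^sup>2 \<partial>lborel) \<le> K * e" if "e > 0" for e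
  proof -
    obtain P where P: "polynomial_function P" "\<And>u. u \<in> {0..1} \<Longrightarrow> norm (\<phi> u - P u) < e"
      using Stone_Weierstrass_polynomial_function[OF compact_Icc cont_\<phi> \<open>e > 0\<close>] by blast
    then have "real_polynomial_function P" by (simp add: real_polynomial_function_eq)
    then obtain a n where Pa: "P = (\<lambda>x. \<Sum>i\<le>n. a i * x ^ i)"
      using real_polynomial_function_imp_sum by blast
    have eqP: "w t * P (exp (- t)) = (\<Sum>i\<le>n. a i * (w t * exp (- t) ^ i))" for t
      by (simp add: Pa sum_distrib_left algebra_simps)
    have P_int: "integrable lborel (\<lambda>t. w t * P (exp (- t)))"
      unfolding eqP by (intro Bochner_Integration.integrable_sum integrable_mult_right mono_int)
    have P0: "(\<integral>t. w t * P (exp (- t)) \<partial>lborel) = 0"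
      unfolding eqP by (subst Bochner_Integration.integral_sum) (auto intro!: integrable_mult_right mono_int simp: mono_zero)
    have "(\<integral>t. (w t)\<^sup>2 \<partial>lborel) = (\<integral>t. (w t)\<^sup>2 - w t * P (exp (- t)) \<partial>lborel)"
      using sq_int P_int P0 by simp
    also have "\<dots> \<le> (\<integral>t. (K * e) * (indicator {0..} t * exp (- t)) \<partial>lborel)"
    proof (rule integral_mono)
      fix t :: real
      show "(w t)\<^sup>2 - w t * P (exp (- t)) \<le> (K * e) * (indicator {0..} t * exp (- t))"
      proof (cases "0 \<le> t")
        case True
        then have "(w t)\<^sup>2 - w t * P (exp (- t)) = w t * (\<phi> (exp (- t)) - P (exp (- t)))"
          by (simp add: \<phi>_exp w_def power2_eq_square algebra_simps)
        also have "\<dots> \<le> \<bar>w t\<bar> * \<bar>\<phi> (exp (- t)) - P (exp (- t))\<bar>"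
          by (metis abs_ge_self abs_mult)
        also have "\<dots> \<le> (K * (indicator {0..} t * exp (- t))) * e"
          using P(2)[of "exp (- t)"] True K0 by (intro mult_mono w_le) auto
        finally show ?thesis by (simp add: ac_simps)
      qed (simp add: w_def)
    qed (auto intro!: Bochner_Integration.integrable_diff sq_int P_int integrable_mult_right exp_int)
    also have "\<dots> = K * e" using exp_eq by simp
    finally show ?thesis .
  qed
  have sq0: "(\<integral>t. (w t)\<^sup>2 \<partial>lborel) \<le> 0"
  proof (rule tendsto_lowerbound)
    show "((\<lambda>e. K * e) \<longlongrightarrow> 0) (at_right 0)" by (auto intro!: tendsto_eq_intros)
    show "\<forall>\<^sub>F e in at_right 0. (\<integral>t. (w t)\<^sup>2 \<partial>lborel) \<le> K * e"
      using small by (auto simp: eventually_at_filter)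
  qed auto
  \<comment> \<open>A version of the square of \<open>w\<close> without the jump at 0. Integrating
    up to \<open>t0 + 1\<close> keeps the interval nondegenerate even for \<open>t0 = 0\<close>, so
    that a nonnegative continuous function with zero integral vanishes at \<open>t0\<close>.\<close>
  define v where "v t = (g t * exp (- t))\<^sup>2" for t
  have cv: "continuous_on {0..t0 + 1} v"
    unfolding v_def by (intro continuous_intros continuous_on_subset[OF cont]) auto
  have vi: "set_integrable lborel {0..t0+1} v"
    by (rule borel_integrable_atLeastAtMost'[OF cv])
  have "(LINT t:{0..t0+1}|lborel. v t) \<le> (\<integral>t. (w t)\<^sup>2 \<partial>lborel)"
    unfolding set_lebesgue_integral_def
    by (rule integral_mono) (use vi sq_int in \<open>auto simp: set_integrable_def w_def v_def indicator_def\<close>)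
  moreover have "(LINT t:{0..t0+1}|lborel. v t) \<ge> 0"
    unfolding set_lebesgue_integral_def by (intro Bochner_Integration.integral_nonneg) (auto simp: v_def)
  ultimately have "integral {0..t0+1} v = 0"
    using set_borel_integral_eq_integral(2)[OF vi] sq0 by simp
  then have "(v has_integral 0) (cbox 0 (t0+1))"
    using set_borel_integral_eq_integral(1)[OF vi] by (metis cbox_interval integrable_integral)
  then have "v t0 = 0"
    by (intro has_integral_0_cbox_imp_0[of 0 "t0+1" v]) (use cv \<open>0 \<le> t0\<close> in \<open>auto simp: v_def box_real\<close>)
  then show ?thesis by (simp add: v_def)
qed

subsection \<open>Integration against a finite measure\<close>

text \<open>As \<open>M2\<close> is finite, a majorant depending on the first variable alone is
  integrable over the product. This justifies the exchange of integrals for both the Bromwich and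
  the Laplace integral.\<close>

lemma (in pair_sigma_finite) integrable_pair_bound:
  fixes f :: "'a \<Rightarrow> 'b \<Rightarrow> 'c::{banach, second_countable_topology}"
  assumes "finite_measure M2"
    and [measurable]: "case_prod f \<in> borel_measurable (M1 \<Otimes>\<^sub>M M2)"
    and g: "integrable M1 (g :: 'a \<Rightarrow> real)"
    and le: "\<And>s x. s \<in> space M1 \<Longrightarrow> x \<in> space M2 \<Longrightarrow> norm (f s x) \<le> g s"
  shows "integrable (M1 \<Otimes>\<^sub>M M2) (case_prod f)"
proof (rule Bochner_Integration.integrable_bound)
  interpret M2: finite_measure M2 by fact
  have [measurable]: "g \<in> borel_measurable M1" using g by simp
  show "integrable (M1 \<Otimes>\<^sub>M M2) (\<lambda>(s, x). g s)"
  proof (rule Fubini_integrable)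
    show "integrable M1 (\<lambda>s. \<integral>x. norm (case (s, x) of (s, x) \<Rightarrow> g s) \<partial>M2)"
      using g by simp
  qed auto
  show "AE z in M1 \<Otimes>\<^sub>M M2. norm (case_prod f z) \<le> norm (case z of (s, x) \<Rightarrow> g s)"
    by (intro AE_I2) (auto simp: space_pair_measure intro: order_trans[OF le])
qed fact

text \<open>After Fubini the error for each \<open>x\<close> is at most
  \<open>exp \<gamma> / (pi * T)\<close>, so the total error is at most this times the mass of
  \<open>\<nu>\<close>. Only the values \<open>a x\<close> enter; they will be
  \<open>p \<bullet> x\<close>.\<close>

lemma Bromwich_Stieltjes:
  fixes \<nu> :: "'b measure" and a :: "'b \<Rightarrow> real"
  assumes "finite_measure \<nu>" and [measurable]: "a \<in> borel_measurable \<nu>"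
    and nonneg: "\<And>x. x \<in> space \<nu> \<Longrightarrow> 0 \<le> a x" and "0 < \<gamma>"
  shows "((\<lambda>T. 1 / (2 * of_real pi * \<i>) *
      contour_integral (linepath (Complex \<gamma> (- T)) (Complex \<gamma> T))
        (\<lambda>z. (\<integral>x. 1 / (z + of_real (a x)) \<partial>\<nu>) * exp z))
    \<longlongrightarrow> of_real (\<integral>x. exp (- a x) \<partial>\<nu>)) at_top"
proof -
  interpret \<nu>: finite_measure \<nu> by fact
  interpret P: pair_sigma_finite lborel \<nu> ..
  let ?J = "\<lambda>T z. contour_integral (linepath (Complex \<gamma> (- T)) (Complex \<gamma> T)) z"
  have bound: "norm (1 / (2 * of_real pi * \<i>) *
        ?J T (\<lambda>z. (\<integral>x. 1 / (z + of_real (a x)) \<partial>\<nu>) * exp z) - of_real (\<integral>x. exp (- a x) \<partial>\<nu>))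
      \<le> exp \<gamma> / (pi * T) * measure \<nu> (space \<nu>)" if T: "0 < T" for T
  proof -
    define d where "d = Complex \<gamma> T - Complex \<gamma> (- T)"
    define l where "l = linepath (Complex \<gamma> (- T)) (Complex \<gamma> T)"
    \<comment> \<open>The integrand pulled back to the parameter interval, with the constant
      derivative \<open>d\<close> of the segment as a factor; the indicator turns it into a function
      on the whole line, as Fubini with \<open>lborel\<close> requires.\<close>
    define h where "h t x = indicator {0..1::real} t *\<^sub>R (1 / (l t + of_real (a x)) * exp (l t) * d)" for t x
    have cont_l: "continuous_on S l" for S unfolding l_def by (rule continuous_on_linepath)
    have [measurable]: "l \<in> borel_measurable borel"
      by (rule borel_measurable_continuous_onI[OF cont_l])
    have Re_l: "Re (l t) = \<gamma>" for t
      by (simp add: l_def linepath_def algebra_simps)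
    \<comment> \<open>The segment stays at real part \<gamma> and the poles are at nonpositive
      reals, so the kernel is at most \<open>1 / \<gamma>\<close> uniformly in \<open>t\<close> and
      \<open>x\<close>.\<close>
    have norm_l: "\<gamma> \<le> norm (l t + of_real c)" if "0 \<le> c" for t c
      using complex_Re_le_cmod[of "l t + of_real c"] that by (simp add: Re_l)
    have nz: "l t + of_real c \<noteq> 0" if "0 \<le> c" for t c
      using norm_l[OF that, of t] \<open>0 < \<gamma>\<close> by auto
    have h_le: "norm (h t x) \<le> indicator {0..1} t * (exp \<gamma> * norm d / \<gamma>)" if "x \<in> space \<nu>" for t x
      using norm_l[OF nonneg[OF that], of t] \<open>0 < \<gamma>\<close>
      by (auto simp: h_def indicator_def norm_mult norm_divide norm_exp_eq_Re Re_l intro!: frac_le)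
    have h_int: "integrable (lborel \<Otimes>\<^sub>M \<nu>) (case_prod h)"
    proof (rule P.integrable_pair_bound[OF \<open>finite_measure \<nu>\<close>])
      show "case_prod h \<in> borel_measurable (lborel \<Otimes>\<^sub>M \<nu>)"
        unfolding h_def by measurable
      show "integrable lborel (\<lambda>t::real. indicator {0..1} t * (exp \<gamma> * norm d / \<gamma>))"
        by (intro integrable_mult_left integrable_real_indicator) auto
    qed (rule h_le)
    have inner: "?J T (\<lambda>z. exp z / (z + of_real (a x))) = (\<integral>t. h t x \<partial>lborel)" if "x \<in> space \<nu>" for x
    proof -
      have "continuous_on {0..1} (\<lambda>t. 1 / (l t + of_real (a x)) * exp (l t) * d)"
        by (intro continuous_intros cont_l) (use nz[OF nonneg[OF that]] in auto)
      from set_borel_integral_eq_integral[OF borel_integrable_atLeastAtMost'[OF this]]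
      have "((\<lambda>t. 1 / (l t + of_real (a x)) * exp (l t) * d) has_integral (\<integral>t. h t x \<partial>lborel)) {0..1}"
        by (simp add: h_def set_lebesgue_integral_def has_integral_iff)
      then have "((\<lambda>z. exp z / (z + of_real (a x))) has_contour_integral (\<integral>t. h t x \<partial>lborel)) l"
        by (simp add: l_def has_contour_integral_linepath d_def)
      then show ?thesis by (simp add: contour_integral_unique l_def)
    qed
    have outer_eq: "(\<integral>x. h t x \<partial>\<nu>) =
        indicator {0..1} t *\<^sub>R ((\<integral>x. 1 / (l t + of_real (a x)) \<partial>\<nu>) * exp (l t) * d)" for t
      by (simp only: h_def integral_scaleR_right integral_mult_left_zero)
    \<comment> \<open>Integrability in \<open>t\<close> after averaging over \<open>\<nu>\<close> is
      part of Fubini's theorem; it yields the existence of the contour integral of the Stieltjes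
      function.\<close>
    have "set_integrable lborel {0..1} (\<lambda>t. (\<integral>x. 1 / (l t + of_real (a x)) \<partial>\<nu>) * exp (l t) * d)"
      using P.integrable_fst[OF h_int] by (simp add: outer_eq set_integrable_def)
    note set_borel_integral_eq_integral[OF this, unfolded set_lebesgue_integral_def]
    then have "((\<lambda>t. (\<integral>x. 1 / (l t + of_real (a x)) \<partial>\<nu>) * exp (l t) * d) has_integral
        (\<integral>t. (\<integral>x. h t x \<partial>\<nu>) \<partial>lborel)) {0..1}"
      unfolding has_integral_iff outer_eq by auto
    then have "((\<lambda>z. (\<integral>x. 1 / (z + of_real (a x)) \<partial>\<nu>) * exp z) has_contour_integral
        (\<integral>t. (\<integral>x. h t x \<partial>\<nu>) \<partial>lborel)) l"
      by (simp add: l_def has_contour_integral_linepath d_def)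
    then have J: "?J T (\<lambda>z. (\<integral>x. 1 / (z + of_real (a x)) \<partial>\<nu>) * exp z) = (\<integral>x. (\<integral>t. h t x \<partial>lborel) \<partial>\<nu>)"
      by (simp add: contour_integral_unique l_def P.Fubini_integral[OF h_int])
    have h_int': "integrable \<nu> (\<lambda>x. \<integral>t. h t x \<partial>lborel)"
      by (rule P.integrable_snd[OF h_int])
    have exp_int: "integrable \<nu> (\<lambda>x. exp (- a x))"
      by (rule \<nu>.integrable_const_bound[of _ 1]) (auto intro!: AE_I2 simp: nonneg)
    define c where "c = 1 / (2 * of_real pi * \<i>)"
    have "c * ?J T (\<lambda>z. (\<integral>x. 1 / (z + of_real (a x)) \<partial>\<nu>) * exp z) - of_real (\<integral>x. exp (- a x) \<partial>\<nu>)
        = (\<integral>x. c * (\<integral>t. h t x \<partial>lborel) - of_real (exp (- a x)) \<partial>\<nu>)"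
      unfolding J using h_int' exp_int
      by (subst Bochner_Integration.integral_diff) auto
    also have "norm \<dots> \<le> (\<integral>x. exp \<gamma> / (pi * T) \<partial>\<nu>)"
    proof (rule order_trans[OF integral_norm_bound integral_mono])
      fix x assume x: "x \<in> space \<nu>"
      have "c * (\<integral>t. h t x \<partial>lborel) - of_real (exp (- a x)) =
          c * (?J T (\<lambda>z. exp z / (z + of_real (a x))) - 2 * of_real pi * \<i> * of_real (exp (- a x)))"
        unfolding inner[OF x] by (simp add: c_def field_simps)
      also have "norm \<dots> \<le> norm c * (2 * exp \<gamma> / T)"
        unfolding norm_mult
        by (intro mult_left_mono Bromwich_exp_bound nonneg x \<open>0 < \<gamma>\<close> T) auto
      also have "norm c * (2 * exp \<gamma> / T) = exp \<gamma> / (pi * T)"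
        by (simp add: c_def norm_divide norm_mult)
      finally show "norm (c * (\<integral>t. h t x \<partial>lborel) - of_real (exp (- a x))) \<le> exp \<gamma> / (pi * T)" .
    qed (use h_int' exp_int in auto)
    finally show ?thesis unfolding c_def by (simp add: ac_simps)
  qed
  have "((\<lambda>T. 1 / (2 * of_real pi * \<i>) *
      ?J T (\<lambda>z. (\<integral>x. 1 / (z + of_real (a x)) \<partial>\<nu>) * exp z) - of_real (\<integral>x. exp (- a x) \<partial>\<nu>)) \<longlongrightarrow> 0) at_top"
  proof (rule Lim_null_comparison)
    show "((\<lambda>T. exp \<gamma> / (pi * T) * measure \<nu> (space \<nu>)) \<longlongrightarrow> 0) at_top"
      by real_asymp
    show "\<forall>\<^sub>F T in at_top. norm (1 / (2 * of_real pi * \<i>) *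
      ?J T (\<lambda>z. (\<integral>x. 1 / (z + of_real (a x)) \<partial>\<nu>) * exp z) - of_real (\<integral>x. exp (- a x) \<partial>\<nu>))
      \<le> exp \<gamma> / (pi * T) * measure \<nu> (space \<nu>)"
      using eventually_gt_at_top[of 0] by eventually_elim (rule bound)
  qed
  then show ?thesis by (rule LIM_zero_cancel)
qed

text \<open>The Stieltjes transform is a twofold Laplace transform. Since \<open>a\<close> is
  nonnegative, \<open>exp (- s * t)\<close> is an integrable majorant for Fubini, and the inner
  integral becomes that of \<open>exp (- (s + a x) * t)\<close>.\<close>

lemma Laplace_of_Laplace:
  fixes \<nu> :: "'b measure" and a :: "'b \<Rightarrow> real"
  assumes "finite_measure \<nu>" and [measurable]: "a \<in> borel_measurable \<nu>"
    and nonneg: "\<And>x. x \<in> space \<nu> \<Longrightarrow> 0 \<le> a x" and "0 < s"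
  shows "(LINT t:{0..}|lborel. (\<integral>x. exp (- (t * a x)) \<partial>\<nu>) * exp (- t * s)) = (\<integral>x. 1 / (s + a x) \<partial>\<nu>)"
proof -
  interpret \<nu>: finite_measure \<nu> by fact
  interpret P: pair_sigma_finite lborel \<nu> ..
  define h where "h t x = indicat_real {0..} t * exp (- (s + a x) * t)" for t x
  have h_int: "integrable (lborel \<Otimes>\<^sub>M \<nu>) (case_prod h)"
  proof (rule P.integrable_pair_bound[OF \<open>finite_measure \<nu>\<close>])
    show "case_prod h \<in> borel_measurable (lborel \<Otimes>\<^sub>M \<nu>)"
      unfolding h_def by measurable
    show "integrable lborel (\<lambda>t. indicat_real {0..} t * exp (- s * t))"
      using has_bochner_integral_exp_Ici[OF \<open>0 < s\<close>] by (simp add: has_bochner_integral_iff)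
    show "norm (h t x) \<le> indicat_real {0..} t * exp (- s * t)" if "x \<in> space \<nu>" for t x
      using nonneg[OF that] by (auto simp: h_def indicator_def algebra_simps)
  qed
  have "(LINT t:{0..}|lborel. (\<integral>x. exp (- (t * a x)) \<partial>\<nu>) * exp (- t * s)) = (\<integral>t. (\<integral>x. h t x \<partial>\<nu>) \<partial>lborel)"
    unfolding set_lebesgue_integral_def
  proof (rule Bochner_Integration.integral_cong[OF refl])
    fix t :: real
    have "h t x = indicat_real {0..} t * (exp (- (t * a x)) * exp (- t * s))" for x
      by (simp add: h_def algebra_simps flip: exp_add)
    then show "indicat_real {0..} t *\<^sub>R ((\<integral>x. exp (- (t * a x)) \<partial>\<nu>) * exp (- t * s)) = (\<integral>x. h t x \<partial>\<nu>)"
      by simp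
  qed
  also have "\<dots> = (\<integral>x. (\<integral>t. h t x \<partial>lborel) \<partial>\<nu>)"
    by (rule P.Fubini_integral[OF h_int, symmetric])
  also have "\<dots> = (\<integral>x. 1 / (s + a x) \<partial>\<nu>)"
  proof (rule Bochner_Integration.integral_cong[OF refl])
    fix x assume "x \<in> space \<nu>"
    then have "0 < s + a x" using nonneg[of x] \<open>0 < s\<close> by simp
    from has_bochner_integral_exp_Ici[OF this]
    show "(\<integral>t. h t x \<partial>lborel) = 1 / (s + a x)"
      by (simp add: h_def has_bochner_integral_iff)
  qed
  finally show ?thesis .
qed

subsection \<open>Laplace transforms are completely monotone\<close>

text \<open>On an open set, equality of functions passes to their derivatives. This allows the
  extensional restriction to stand in for the Laplace integral, and a moment for a
  derivative.\<close>

lemma Ck_on_cong: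
  assumes "open S" "\<And>p. p \<in> S \<Longrightarrow> f p = g p" "Ck_on k f S"
  shows "Ck_on k g S"
  using assms(2,3)
proof (induction k arbitrary: f g)
  case 0
  then show ?case by (auto intro: continuous_on_eq)
next
  case (Suc k)
  have diff: "f differentiable (at p)" if "p \<in> S" for p
    using Suc.prems that by simp
  have g': "(g has_derivative frechet_derivative f (at p)) (at p)" if "p \<in> S" for p
    using diff[OF that] \<open>open S\<close> that Suc.prems(1)
    by (auto simp: frechet_derivative_works intro: has_derivative_transform_within_open)
  then have eq: "frechet_derivative f (at p) = frechet_derivative g (at p)" if "p \<in> S" for p
    using that by (simp add: frechet_derivative_at)
  have "Ck_on k (\<lambda>p. frechet_derivative g (at p) j) S" if "j \<in> Basis" for j
    by (rule Suc.IH[of "\<lambda>p. frechet_derivative f (at p) j"]) (use Suc.prems that eq in auto)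
  then show ?case using g' by (auto intro: differentiableI)
qed

section \<open>Directional derivatives and growth estimates on the dual cone\<close>

lemma dir_deriv_eq_frechet:
  assumes "f differentiable (at p)"
  shows "dir_deriv \<xi> f p = frechet_derivative f (at p) \<xi>"
proof -
  have lin: "linear (frechet_derivative f (at p))"
    by (rule linear_frechet_derivative[OF assms])
  have "frechet_derivative f (at p) (\<Sum>j\<in>Basis. (\<xi> \<bullet> j) *\<^sub>R j) = dir_deriv \<xi> f p"
    unfolding dir_deriv_def linear_sum[OF lin] linear_scale[OF lin] by simp
  then show ?thesis by (simp add: euclidean_representation)
qed

text \<open>A ball of radius \<open>e\<close> around \<open>p\<close> lies in \<open>C\<close>;
  testing \<open>x\<close> against its point \<open>p - e *\<^sub>R sgn x\<close> gives the
  estimate.\<close>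

lemma interior_dual_coercive:
  assumes "p \<in> interior C"
  obtains \<epsilon> where "0 < \<epsilon>" "\<And>x. x \<in> dual_cone C \<Longrightarrow> \<epsilon> * norm x \<le> p \<bullet> x"
proof -
  obtain e where e: "0 < e" "cball p e \<subseteq> C"
    using assms by (auto simp: mem_interior_cball)
  have "e * norm x \<le> p \<bullet> x" if "x \<in> dual_cone C" for x
  proof -
    have "norm (sgn x) \<le> 1" by (simp add: norm_sgn)
    then have "p - e *\<^sub>R sgn x \<in> cball p e" using e by (simp add: dist_norm)
    then have "p - e *\<^sub>R sgn x \<in> C" using e by blast
    then have "0 \<le> x \<bullet> (p - e *\<^sub>R sgn x)" using that by (auto simp: dual_cone_def)
    moreover have "x \<bullet> sgn x = norm x"
      by (cases "x = 0") (simp_all add: sgn_div_norm dot_square_norm power2_eq_square)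
    ultimately show ?thesis by (simp add: inner_diff_right inner_commute)
  qed
  with e(1) that show ?thesis by blast
qed

lemma power_exp_bounded:
  fixes \<epsilon> :: real
  assumes "0 < \<epsilon>"
  obtains M where "\<And>y. 0 \<le> y \<Longrightarrow> y ^ n * exp (- \<epsilon> * y) \<le> M"
proof -
  \<comment> \<open>The estimate \<open>v \<le> exp v\<close> is applied to
    \<open>v = \<epsilon> * y / m\<close> and raised to the power \<open>n\<close>. Taking
    \<open>n + 1\<close> rather than \<open>n\<close> avoids division by zero when
    \<open>n = 0\<close>.\<close>
  define m where "m = real (Suc n)"
  have "y ^ n * exp (- \<epsilon> * y) \<le> (m / \<epsilon>) ^ n" if "0 \<le> y" for y
  proof -
    have "y = (m / \<epsilon>) * (\<epsilon> * y / m)" using assms by (simp add: m_def)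
    also have "\<dots> \<le> (m / \<epsilon>) * exp (\<epsilon> * y / m)"
    proof (rule mult_left_mono)
      show "\<epsilon> * y / m \<le> exp (\<epsilon> * y / m)"
        using exp_ge_add_one_self[of "\<epsilon> * y / m"] by linarith
    qed (use assms in \<open>simp add: m_def\<close>)
    finally have "y ^ n \<le> ((m / \<epsilon>) * exp (\<epsilon> * y / m)) ^ n"
      using that by (intro power_mono)
    also have "\<dots> = (m / \<epsilon>) ^ n * exp (real n * (\<epsilon> * y / m))"
      unfolding power_mult_distrib exp_of_nat_mult ..
    also have "real n * (\<epsilon> * y / m) \<le> m * (\<epsilon> * y / m)"
      using assms that by (intro mult_right_mono) (auto simp: m_def)
    then have "(m / \<epsilon>) ^ n * exp (real n * (\<epsilon> * y / m)) \<le> (m / \<epsilon>) ^ n * exp (\<epsilon> * y)"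
      using assms by (intro mult_left_mono) (auto simp: m_def)
    finally have "y ^ n * exp (- \<epsilon> * y) \<le> (m / \<epsilon>) ^ n * exp (\<epsilon> * y) * exp (- \<epsilon> * y)"
      by (intro mult_right_mono) auto
    then show ?thesis by (simp add: mult.assoc flip: exp_add)
  qed
  with that show ?thesis by blast
qed

text \<open>The factor that differentiation in \<open>p\<close> along the listed directions brings
  down from \<open>exp (- (p \<bullet> x))\<close>. The signs are kept inside, so one more
  derivative is one more list element.\<close>

definition directional_monomial :: "'a::real_inner list \<Rightarrow> 'a \<Rightarrow> real" where
  "directional_monomial \<xi>s x = (\<Prod>\<xi>\<leftarrow>\<xi>s. - (\<xi> \<bullet> x))"

lemma directional_monomial_simps [simp]:
  "directional_monomial [] x = 1"
  "directional_monomial (\<xi> # \<xi>s) x = - (\<xi> \<bullet> x) * directional_monomial \<xi>s x"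
  by (simp_all add: directional_monomial_def)

lemma directional_monomial_bound:
  "\<bar>directional_monomial \<xi>s x\<bar> \<le> (\<Prod>\<xi>\<leftarrow>\<xi>s. norm \<xi>) * norm x ^ length \<xi>s"
proof (induction \<xi>s)
  case (Cons \<xi> \<xi>s)
  have "\<bar>directional_monomial (\<xi> # \<xi>s) x\<bar> = \<bar>\<xi> \<bullet> x\<bar> * \<bar>directional_monomial \<xi>s x\<bar>"
    by (simp add: abs_mult)
  also have "\<dots> \<le> (norm \<xi> * norm x) * ((\<Prod>\<xi>\<leftarrow>\<xi>s. norm \<xi>) * norm x ^ length \<xi>s)"
    by (intro mult_mono Cauchy_Schwarz_ineq2 Cons.IH) auto
  finally show ?case by (simp add: ac_simps)
qed simp

lemma directional_monomial_sign:
  assumes "set \<xi>s \<subseteq> C" "x \<in> dual_cone C"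
  shows "0 \<le> (- 1) ^ length \<xi>s * directional_monomial \<xi>s x"
  using assms(1)
proof (induction \<xi>s)
  case (Cons \<xi> \<xi>s)
  have "0 \<le> \<xi> \<bullet> x" using Cons.prems assms(2) by (auto simp: dual_cone_def inner_commute)
  moreover have "0 \<le> (- 1) ^ length \<xi>s * directional_monomial \<xi>s x" using Cons by simp
  ultimately have "0 \<le> (\<xi> \<bullet> x) * ((- 1) ^ length \<xi>s * directional_monomial \<xi>s x)"
    by (rule mult_nonneg_nonneg)
  then show ?case by (simp add: ac_simps)
qed simp

lemma exp_second_order_bound:
  fixes u :: real
  shows "\<bar>exp u - 1 - u\<bar> \<le> exp \<bar>u\<bar> * u\<^sup>2"
  using Taylor_exp_field[of u 1] by (simp add: algebra_simps power2_eq_square)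

text \<open>The measure lives on a part of the dual cone, so inequalities hold at every point of its
  space. Its sigma-algebra may be a trace of the Borel sets, hence the assumption on the identity
  map.\<close>

locale measure_on_dual = finite_measure \<nu>
  for \<nu> :: "'a::euclidean_space measure" and C :: "'a set" +
  assumes borel_ident [measurable]: "(\<lambda>x. x) \<in> borel_measurable \<nu>"
    and space_dual: "x \<in> space \<nu> \<Longrightarrow> x \<in> dual_cone C"
begin

text \<open>The candidate for the iterated directional derivative of the Laplace transform, which is
  the case of the empty list.\<close>

definition laplace_moment :: "'a list \<Rightarrow> 'a \<Rightarrow> real" where
  "laplace_moment \<xi>s p = (\<integral>x. directional_monomial \<xi>s x * exp (- (p \<bullet> x)) \<partial>\<nu>)"

section \<open>Integrability and differentiation of the moments\<close>

lemma directional_monomial_measurable [measurable]: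
  "directional_monomial \<xi>s \<in> borel_measurable \<nu>"
  by (induction \<xi>s) (simp_all add: directional_monomial_def)

lemma inner_nonneg: "p \<in> C \<Longrightarrow> x \<in> space \<nu> \<Longrightarrow> 0 \<le> p \<bullet> x"
  using space_dual[of x] by (auto simp: dual_cone_def inner_commute)

text \<open>The integrand is bounded and the measure finite. The exponent \<open>q\<close> will be
  \<open>p \<bullet> x\<close>, its perturbation \<open>(p + h) \<bullet> x\<close>, or a multiple
  of \<open>norm x\<close>; the extra power of \<open>norm x\<close> serves the quadratic Taylor
  remainder.\<close>

lemma integrable_monomial_exp:
  assumes "0 < \<epsilon>"
    and [measurable]: "q \<in> borel_measurable \<nu>"
    and q: "\<And>x. x \<in> space \<nu> \<Longrightarrow> \<epsilon> * norm x \<le> q x"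
  shows "integrable \<nu> (\<lambda>x. directional_monomial \<xi>s x * norm x ^ k * exp (- q x))"
proof -
  define A where "A = (\<Prod>\<xi>\<leftarrow>\<xi>s. norm \<xi>)"
  have "0 \<le> A" unfolding A_def by (induction \<xi>s) auto
  obtain M where M: "\<And>y. 0 \<le> y \<Longrightarrow> y ^ (length \<xi>s + k) * exp (- \<epsilon> * y) \<le> M"
    using power_exp_bounded[OF \<open>0 < \<epsilon>\<close>] by blast
  show ?thesis
  proof (rule integrable_const_bound[of _ "A * M"])
    show "AE x in \<nu>. norm (directional_monomial \<xi>s x * norm x ^ k * exp (- q x)) \<le> A * M"
    proof (rule AE_I2)
      fix x assume x: "x \<in> space \<nu>"
      have "norm (directional_monomial \<xi>s x * norm x ^ k * exp (- q x))
          = \<bar>directional_monomial \<xi>s x\<bar> * norm x ^ k * exp (- q x)"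
        by (simp add: abs_mult)
      also have "\<dots> \<le> (A * norm x ^ length \<xi>s) * norm x ^ k * exp (- \<epsilon> * norm x)"
        unfolding A_def using q[OF x] \<open>0 \<le> A\<close>
        by (intro mult_mono directional_monomial_bound) (auto simp: A_def)
      also have "\<dots> = A * (norm x ^ (length \<xi>s + k) * exp (- \<epsilon> * norm x))"
        by (simp add: power_add ac_simps)
      also have "\<dots> \<le> A * M" using \<open>0 \<le> A\<close> by (intro mult_left_mono M) auto
      finally show "norm (directional_monomial \<xi>s x * norm x ^ k * exp (- q x)) \<le> A * M" .
    qed
  qed measurable
qed

lemma laplace_moment_integrable:
  assumes "p \<in> interior C"
  shows "integrable \<nu> (\<lambda>x. directional_monomial \<xi>s x * exp (- (p \<bullet> x)))"
proof -
  obtain \<epsilon> where "0 < \<epsilon>" "\<And>x. x \<in> dual_cone C \<Longrightarrow> \<epsilon> * norm x \<le> p \<bullet> x"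
    using interior_dual_coercive[OF assms] by blast
  then show ?thesis
    using integrable_monomial_exp[of \<epsilon> "\<lambda>x. p \<bullet> x" \<xi>s 0] space_dual by simp
qed

lemma laplace_moment_linear:
  assumes "p \<in> interior C"
  shows "linear (\<lambda>h. laplace_moment (h # \<xi>s) p)"
proof (rule linearI)
  fix h h' :: 'a and c :: real
  have eq: "directional_monomial ((h + h') # \<xi>s) x * exp (- (p \<bullet> x)) =
      directional_monomial (h # \<xi>s) x * exp (- (p \<bullet> x)) +
      directional_monomial (h' # \<xi>s) x * exp (- (p \<bullet> x))" for x
    by (simp add: inner_add_left algebra_simps)
  show "laplace_moment ((h + h') # \<xi>s) p = laplace_moment (h # \<xi>s) p + laplace_moment (h' # \<xi>s) p"
    unfolding laplace_moment_def eq
    by (intro Bochner_Integration.integral_add laplace_moment_integrable[OF assms])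
  have eq: "directional_monomial ((c *\<^sub>R h) # \<xi>s) x * exp (- (p \<bullet> x)) =
      c * (directional_monomial (h # \<xi>s) x * exp (- (p \<bullet> x)))" for x
    by simp
  show "laplace_moment ((c *\<^sub>R h) # \<xi>s) p = c *\<^sub>R laplace_moment (h # \<xi>s) p"
    unfolding laplace_moment_def eq by simp
qed

text \<open>Taylor's formula under the integral sign: the linear term in \<open>h\<close> is the
  moment of the longer list, and the remainder is at most a constant times the square of
  \<open>norm h\<close>.\<close>

lemma laplace_moment_has_derivative:
  assumes p: "p \<in> interior C"
  shows "(laplace_moment \<xi>s has_derivative (\<lambda>h. laplace_moment (h # \<xi>s) p)) (at p)"
proof -
  let ?P = "directional_monomial \<xi>s"
  obtain \<epsilon>' where \<epsilon>': "0 < \<epsilon>'" "\<And>x. x \<in> dual_cone C \<Longrightarrow> \<epsilon>' * norm x \<le> p \<bullet> x"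
    using interior_dual_coercive[OF p] by blast
  \<comment> \<open>Half of the coercivity constant absorbs the growth
    \<open>exp (\<epsilon> * norm x)\<close> caused by a perturbation with
    \<open>norm h \<le> \<epsilon>\<close>; the other half keeps the remainder integrable.\<close>
  define \<epsilon> where "\<epsilon> = \<epsilon>' / 2"
  have \<epsilon>: "0 < \<epsilon>" "\<And>x. x \<in> space \<nu> \<Longrightarrow> 2 * \<epsilon> * norm x \<le> p \<bullet> x"
    using \<epsilon>' space_dual by (auto simp: \<epsilon>_def)
  define B where "B = (\<integral>x. \<bar>?P x\<bar> * norm x ^ 2 * exp (- (\<epsilon> * norm x)) \<partial>\<nu>)"
  have "integrable \<nu> (\<lambda>x. ?P x * norm x ^ 2 * exp (- (\<epsilon> * norm x)))"
    by (rule integrable_monomial_exp[OF \<epsilon>(1)]) auto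
  then have B_int: "integrable \<nu> (\<lambda>x. \<bar>?P x\<bar> * norm x ^ 2 * exp (- (\<epsilon> * norm x)))"
    by (rule Bochner_Integration.integrable_bound) (auto simp: abs_mult)
  have B0: "0 \<le> B" unfolding B_def by (intro Bochner_Integration.integral_nonneg) auto
  have key: "\<bar>laplace_moment \<xi>s (p + h) - laplace_moment \<xi>s p - laplace_moment (h # \<xi>s) p\<bar>
      \<le> B * (norm h)\<^sup>2" if h: "norm h \<le> \<epsilon>" for h
  proof -
    have hx: "\<bar>h \<bullet> x\<bar> \<le> \<epsilon> * norm x" for x
      by (rule order_trans[OF Cauchy_Schwarz_ineq2]) (intro mult_right_mono h norm_ge_zero)
    have 1: "integrable \<nu> (\<lambda>x. ?P x * exp (- ((p + h) \<bullet> x)))"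
    proof -
      have "\<epsilon> * norm x \<le> (p + h) \<bullet> x" if "x \<in> space \<nu>" for x
        using hx[of x] \<epsilon>(2)[OF that] by (simp add: inner_add_left)
      then show ?thesis
        using integrable_monomial_exp[OF \<epsilon>(1), of "\<lambda>x. (p + h) \<bullet> x" \<xi>s 0] by simp
    qed
    note 2 = laplace_moment_integrable[OF p, of \<xi>s]
    note 3 = laplace_moment_integrable[OF p, of "h # \<xi>s"]
    have "laplace_moment \<xi>s (p + h) - laplace_moment \<xi>s p - laplace_moment (h # \<xi>s) p =
        (\<integral>x. ?P x * exp (- ((p + h) \<bullet> x)) - ?P x * exp (- (p \<bullet> x)) -
          directional_monomial (h # \<xi>s) x * exp (- (p \<bullet> x)) \<partial>\<nu>)"
      unfolding laplace_moment_def
      by (simp only: Bochner_Integration.integral_diff 1 2 3 Bochner_Integration.integrable_diff)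
    also have "norm \<dots> \<le> (\<integral>x. (norm h)\<^sup>2 * (\<bar>?P x\<bar> * norm x ^ 2 * exp (- (\<epsilon> * norm x))) \<partial>\<nu>)"
    proof (rule Bochner_Integration.integral_norm_bound_integral)
      fix x assume x: "x \<in> space \<nu>"
      define u where "u = - (h \<bullet> x)"
      have u: "\<bar>u\<bar> \<le> \<epsilon> * norm x" "\<bar>u\<bar> \<le> norm h * norm x"
        using hx[of x] Cauchy_Schwarz_ineq2[of h x] by (auto simp: u_def)
      have "?P x * exp (- ((p + h) \<bullet> x)) - ?P x * exp (- (p \<bullet> x)) -
          directional_monomial (h # \<xi>s) x * exp (- (p \<bullet> x)) =
          ?P x * exp (- (p \<bullet> x)) * (exp u - 1 - u)"
        by (simp add: u_def inner_add_left exp_add exp_diff exp_minus algebra_simps divide_inverse)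
      also have "norm \<dots> = \<bar>?P x\<bar> * (exp (- (p \<bullet> x)) * \<bar>exp u - 1 - u\<bar>)"
        by (simp add: abs_mult)
      also have "\<dots> \<le> \<bar>?P x\<bar> * (exp (- (p \<bullet> x)) * (exp (\<epsilon> * norm x) * (norm h * norm x)\<^sup>2))"
      proof (intro mult_left_mono order_trans[OF exp_second_order_bound] mult_mono)
        show "u\<^sup>2 \<le> (norm h * norm x)\<^sup>2"
          using u(2) by (metis abs_ge_zero power2_abs power_mono)
      qed (use u in auto)
      also have "\<dots> = \<bar>?P x\<bar> * (exp (- (p \<bullet> x) + \<epsilon> * norm x) * (norm h * norm x)\<^sup>2)"
        unfolding exp_add by (simp only: mult.assoc)
      also have "\<dots> \<le> \<bar>?P x\<bar> * (exp (- (\<epsilon> * norm x)) * (norm h * norm x)\<^sup>2)"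
        using \<epsilon>(2)[OF x] by (intro mult_left_mono mult_right_mono) auto
      finally show "norm (?P x * exp (- ((p + h) \<bullet> x)) - ?P x * exp (- (p \<bullet> x)) -
          directional_monomial (h # \<xi>s) x * exp (- (p \<bullet> x)))
          \<le> (norm h)\<^sup>2 * (\<bar>?P x\<bar> * norm x ^ 2 * exp (- (\<epsilon> * norm x)))"
        by (simp add: power_mult_distrib ac_simps)
    qed (intro Bochner_Integration.integrable_diff 1 2 3 integrable_mult_right B_int)+
    also have "\<dots> = B * (norm h)\<^sup>2" by (simp add: B_def)
    finally show ?thesis by simp
  qed
  show ?thesis
  proof (rule has_derivativeI_sandwich[OF \<epsilon>(1), where H = "\<lambda>y. B * norm (y - p)"])
    show "bounded_linear (\<lambda>h. laplace_moment (h # \<xi>s) p)"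
      using laplace_moment_linear[OF p] by (simp add: linear_conv_bounded_linear)
    show "((\<lambda>y. B * norm (y - p)) \<longlongrightarrow> 0) (at p)"
      by (auto intro!: tendsto_eq_intros)
    fix y assume "y \<noteq> p" "dist y p < \<epsilon>"
    then show "norm (laplace_moment \<xi>s y - laplace_moment \<xi>s p - laplace_moment ((y - p) # \<xi>s) p) / norm (y - p)
        \<le> B * norm (y - p)"
      using key[of "y - p"] by (simp add: dist_norm field_simps power2_eq_square)
  qed
qed

section \<open>Smoothness, signs and boundary continuity of the Laplace transform\<close>

lemma laplace_moment_differentiable:
  "p \<in> interior C \<Longrightarrow> laplace_moment \<xi>s differentiable (at p)"
  using laplace_moment_has_derivative differentiable_def by blast

lemma laplace_moment_frechet_derivative:
  "p \<in> interior C \<Longrightarrow> frechet_derivative (laplace_moment \<xi>s) (at p) h = laplace_moment (h # \<xi>s) p"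
  by (simp add: frechet_derivative_at[OF laplace_moment_has_derivative, symmetric])

lemma laplace_moment_Ck: "Ck_on k (laplace_moment \<xi>s) (interior C)"
proof (induction k arbitrary: \<xi>s)
  case 0
  show ?case
    using laplace_moment_differentiable
    by (auto intro!: continuous_at_imp_continuous_on differentiable_imp_continuous_within)
next
  case (Suc k)
  have "Ck_on k (\<lambda>p. frechet_derivative (laplace_moment \<xi>s) (at p) j) (interior C)" for j
    by (rule Ck_on_cong[OF open_interior _ Suc.IH]) (rule laplace_moment_frechet_derivative[symmetric])
  then show ?case by (simp add: laplace_moment_differentiable)
qed

text \<open>The induction hypothesis identifies the inner derivative on \<open>interior C\<close>
  only, but this set is open, so the next derivative is determined there.\<close>

lemma foldr_dir_deriv_laplace:
  assumes F: "\<And>p. p \<in> interior C \<Longrightarrow> F p = laplace_moment [] p"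
    and "p \<in> interior C"
  shows "foldr dir_deriv \<xi>s F p = laplace_moment \<xi>s p"
  using assms(2)
proof (induction \<xi>s arbitrary: p)
  case (Cons \<xi> \<xi>s)
  have D: "(foldr dir_deriv \<xi>s F has_derivative (\<lambda>h. laplace_moment (h # \<xi>s) p)) (at p)"
    using laplace_moment_has_derivative[OF Cons.prems] open_interior Cons.prems
    by (rule has_derivative_transform_within_open) (simp add: Cons.IH)
  then show ?case
    using dir_deriv_eq_frechet[of "foldr dir_deriv \<xi>s F" p \<xi>] frechet_derivative_at[OF D]
    by (auto simp: differentiable_def fun_eq_iff)
qed (simp add: F)

text \<open>Boundary points of \<open>C\<close> are included, where coercivity may fail. The
  exponentials are still at most 1, and constants are integrable for a finite measure, so dominated
  convergence applies.\<close>

lemma laplace_continuous_on: "continuous_on C (laplace_moment [])"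
  unfolding continuous_on_sequentially
proof (intro allI ballI impI, elim conjE)
  fix X :: "nat \<Rightarrow> 'a" and p assume p: "p \<in> C" and X: "\<forall>n. X n \<in> C" "X \<longlonglongrightarrow> p"
  have "(\<lambda>n. \<integral>x. exp (- (X n \<bullet> x)) \<partial>\<nu>) \<longlonglongrightarrow> (\<integral>x. exp (- (p \<bullet> x)) \<partial>\<nu>)"
  proof (rule integral_dominated_convergence[where w = "\<lambda>_. 1"])
    show "AE x in \<nu>. (\<lambda>n. exp (- (X n \<bullet> x))) \<longlonglongrightarrow> exp (- (p \<bullet> x))"
      by (intro AE_I2 tendsto_intros X(2))
    show "AE x in \<nu>. norm (exp (- (X n \<bullet> x))) \<le> 1" for n
      using X(1) by (intro AE_I2) (simp add: inner_nonneg)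
  qed auto
  then show "(laplace_moment [] \<circ> X) \<longlonglongrightarrow> laplace_moment [] p"
    by (simp add: laplace_moment_def o_def)
qed

lemma laplace_in_CM_tilde: "restrict (laplace_moment []) C \<in> CM_tilde C"
proof -
  let ?F = "restrict (laplace_moment []) C"
  have F: "?F p = laplace_moment [] p" if "p \<in> interior C" for p
    using that interior_subset[of C] by auto
  have "continuous_on C ?F"
    using laplace_continuous_on by (rule continuous_on_eq) simp
  moreover have "Ck_on k ?F (interior C)" for k
    by (rule Ck_on_cong[OF open_interior _ laplace_moment_Ck[of _ "[]"]]) (rule F[symmetric])
  moreover have "0 \<le> (- 1) ^ length \<xi>s * foldr dir_deriv \<xi>s ?F p"
    if "set \<xi>s \<subseteq> C" "p \<in> interior C" for \<xi>s p
  proof -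
    have "0 \<le> (\<integral>x. (- 1) ^ length \<xi>s * directional_monomial \<xi>s x * exp (- (p \<bullet> x)) \<partial>\<nu>)"
      by (intro Bochner_Integration.integral_nonneg_AE AE_I2 mult_nonneg_nonneg
            directional_monomial_sign[OF that(1)] space_dual) auto
    also have "\<dots> = (- 1) ^ length \<xi>s * laplace_moment \<xi>s p"
      by (simp add: laplace_moment_def mult.assoc)
    finally show ?thesis
      using foldr_dir_deriv_laplace[of ?F p \<xi>s, OF F that(2)] by simp
  qed
  ultimately show ?thesis
    by (auto simp: CM_tilde_def completely_monotone_def)
qed

end

subsection \<open>Injectivity of the Borel transform\<close>

lemma interior_cone_scaleR:
  fixes C :: "'a::real_normed_vector set"
  assumes "cone C" "p \<in> interior C" "0 < t"
  shows "t *\<^sub>R p \<in> interior C"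
proof (rule interiorI)
  show "open ((*\<^sub>R) t ` interior C)" using assms by (intro open_scaling) auto
  show "(*\<^sub>R) t ` interior C \<subseteq> C"
    using assms interior_subset[of C] by (auto intro!: mem_cone)
qed (use assms in auto)

lemma continuous_on_cone_ray:
  fixes C :: "'a::real_normed_vector set"
  assumes "cone C" "continuous_on C F" "p \<in> C"
  shows "continuous_on {0..} (\<lambda>t. F (t *\<^sub>R p))"
  by (rule continuous_on_compose2[OF assms(2) continuous_on_scaleR[OF continuous_on_id continuous_on_const]])
     (auto intro: mem_cone[OF assms(1,3)])

text \<open>Complete monotonicity of order 0 gives the sign. Order 1 in the direction
  \<open>p\<close> makes \<open>F\<close> nonincreasing along the ray through \<open>p\<close>, and
  continuity on \<open>C\<close> reaches its end point 0, which need not be interior.\<close>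

lemma CM_tilde_bounds:
  assumes "cone C" and F: "F \<in> CM_tilde C" and p: "p \<in> interior C"
  shows "0 \<le> F p" "F p \<le> F 0"
proof -
  have pC: "p \<in> C" using p interior_subset by blast
  have cont: "continuous_on C F" using F by (simp add: CM_tilde_def)
  have cm: "0 \<le> (- 1) ^ length \<xi>s * foldr dir_deriv \<xi>s F q" if "set \<xi>s \<subseteq> C" "q \<in> interior C" for \<xi>s q
    using F that by (auto simp: CM_tilde_def completely_monotone_def)
  show "0 \<le> F p" using cm[of "[]" p] p by simp
  have diff: "F differentiable (at q)" if "q \<in> interior C" for q
  proof -
    have "Ck_on (Suc 0) F (interior C)"
      using F unfolding CM_tilde_def completely_monotone_def by blast
    then show ?thesis using that by simp
  qed
  have "F (1 *\<^sub>R p) \<le> F (0 *\<^sub>R p)"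
  proof (rule DERIV_nonpos_imp_decreasing_open[of 0 1 "\<lambda>t. F (t *\<^sub>R p)"])
    show "continuous_on {0..1} (\<lambda>t. F (t *\<^sub>R p))"
      by (rule continuous_on_subset[OF continuous_on_cone_ray[OF \<open>cone C\<close> cont pC]]) auto
    fix t :: real assume "0 < t"
    then have tp: "t *\<^sub>R p \<in> interior C" using interior_cone_scaleR[OF \<open>cone C\<close> p] by blast
    let ?D = "frechet_derivative F (at (t *\<^sub>R p))"
    have D: "(F has_derivative ?D) (at (t *\<^sub>R p))"
      using diff[OF tp] frechet_derivative_works by blast
    have "((\<lambda>t. F (t *\<^sub>R p)) has_derivative (\<lambda>s. ?D (s *\<^sub>R p))) (at t)"
      by (rule has_derivative_compose[of "\<lambda>t. t *\<^sub>R p" "\<lambda>s. s *\<^sub>R p", OF _ D])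
         (auto intro!: derivative_eq_intros)
    moreover have "?D (s *\<^sub>R p) = ?D p * s" for s
      using linear_scale[OF linear_frechet_derivative[OF diff[OF tp]]] by simp
    ultimately have "((\<lambda>t. F (t *\<^sub>R p)) has_field_derivative ?D p) (at t)"
      by (simp add: has_field_derivative_def)
    moreover have "?D p \<le> 0"
      using cm[of "[p]" "t *\<^sub>R p"] pC tp dir_deriv_eq_frechet[OF diff[OF tp], of p] by simp
    ultimately show "\<exists>y. ((\<lambda>t. F (t *\<^sub>R p)) has_field_derivative y) (at t) \<and> y \<le> 0" by blast
  qed simp
  then show "F p \<le> F 0" by simp
qed

section \<open>The Borel transform along rays\<close>

lemma CM_tilde_ray_bound:
  assumes "cone C" "F \<in> CM_tilde C" "p \<in> interior C" "0 \<le> t"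
  shows "\<bar>F (t *\<^sub>R p)\<bar> \<le> \<bar>F 0\<bar>"
proof (cases "t = 0")
  case False
  then have "t *\<^sub>R p \<in> interior C"
    using assms by (intro interior_cone_scaleR) auto
  from CM_tilde_bounds[OF assms(1,2) this] show ?thesis by linarith
qed simp

lemma CM_tilde_ray_integrable:
  assumes "cone C" and F: "F \<in> CM_tilde C" and p: "p \<in> interior C" and "0 < s"
  shows "set_integrable lborel {0..} (\<lambda>t. F (t *\<^sub>R p) * exp (- t * s))"
  unfolding set_integrable_def
proof (rule Bochner_Integration.integrable_bound)
  have pC: "p \<in> C" using p interior_subset by blast
  show "integrable lborel (\<lambda>t. F 0 * (indicat_real {0..} t * exp (- s * t)))"
    using has_bochner_integral_exp_Ici[OF \<open>0 < s\<close>] by (simp add: has_bochner_integral_iff)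
  have "continuous_on {0..} (\<lambda>t. F (t *\<^sub>R p) * exp (- t * s))"
    using F pC by (auto simp: CM_tilde_def intro!: continuous_intros continuous_on_cone_ray[OF \<open>cone C\<close>])
  from borel_measurable_continuous_on_indicator[OF _ this]
  show "(\<lambda>t. indicat_real {0..} t *\<^sub>R (F (t *\<^sub>R p) * exp (- t * s))) \<in> borel_measurable lborel"
    by simp
  show "AE t in lborel. norm (indicat_real {0..} t *\<^sub>R (F (t *\<^sub>R p) * exp (- t * s)))
      \<le> norm (F 0 * (indicat_real {0..} t * exp (- s * t)))"
  proof (rule AE_I2)
    fix t
    show "norm (indicat_real {0..} t *\<^sub>R (F (t *\<^sub>R p) * exp (- t * s)))
        \<le> norm (F 0 * (indicat_real {0..} t * exp (- s * t)))"
      using CM_tilde_ray_bound[OF \<open>cone C\<close> F p, of t]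
      by (cases "0 \<le> t") (simp_all add: abs_mult mult.commute)
  qed
qed

text \<open>For fixed \<open>p\<close> the Borel transform is the Laplace transform of
  \<open>F\<close> along the ray through \<open>p\<close>, and its values at positive integers
  determine \<open>F\<close> there. Continuity passes from the interior to \<open>C\<close>, and
  extensionality settles the rest.\<close>

lemma borel_transform_inj_on:
  assumes "cone C" "convex C" "closed C" "interior C \<noteq> {}"
  shows "inj_on (borel_transform C) (CM_tilde C)"
proof (rule inj_onI)
  fix F G assume F: "F \<in> CM_tilde C" and G: "G \<in> CM_tilde C"
    and eq: "borel_transform C F = borel_transform C G"
  have cont: "continuous_on C F" "continuous_on C G"
    using F G by (auto simp: CM_tilde_def)
  have int: "F p - G p = 0" if p: "p \<in> interior C" for p
  proof -
    have pC: "p \<in> C" using p interior_subset by blast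
    \<comment> \<open>Lerch's theorem is used at the parameter \<open>t0 = 1\<close>, where the ray
      passes through \<open>p\<close>.\<close>
    have "F (1 *\<^sub>R p) - G (1 *\<^sub>R p) = 0"
    proof (rule Lerch_uniqueness[of "\<lambda>t. F (t *\<^sub>R p) - G (t *\<^sub>R p)" "\<bar>F 0\<bar> + \<bar>G 0\<bar>"])
      show "continuous_on {0..} (\<lambda>t. F (t *\<^sub>R p) - G (t *\<^sub>R p))"
        by (intro continuous_on_diff continuous_on_cone_ray[OF \<open>cone C\<close> _ pC] cont)
      show "\<bar>F (t *\<^sub>R p) - G (t *\<^sub>R p)\<bar> \<le> \<bar>F 0\<bar> + \<bar>G 0\<bar>" if "0 \<le> t" for t
        using CM_tilde_ray_bound[OF \<open>cone C\<close> F p that] CM_tilde_ray_bound[OF \<open>cone C\<close> G p that]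
        by linarith
      fix n :: nat assume n: "0 < n"
      have "borel_transform C F (p, real n) = borel_transform C G (p, real n)"
        by (simp add: eq)
      then have "(LINT t:{0..}|lborel. F (t *\<^sub>R p) * exp (- t * real n)) =
          (LINT t:{0..}|lborel. G (t *\<^sub>R p) * exp (- t * real n))"
        using pC n by (simp add: borel_transform_def)
      moreover have "(LINT t:{0..}|lborel. (F (t *\<^sub>R p) - G (t *\<^sub>R p)) * exp (- t * real n)) =
          (LINT t:{0..}|lborel. F (t *\<^sub>R p) * exp (- t * real n)) -
          (LINT t:{0..}|lborel. G (t *\<^sub>R p) * exp (- t * real n))"
        unfolding left_diff_distrib
        by (intro set_integral_diff CM_tilde_ray_integrable[OF \<open>cone C\<close> _ p] F G) (use n in auto)
      ultimately show "(LINT t:{0..}|lborel. (F (t *\<^sub>R p) - G (t *\<^sub>R p)) * exp (- t * real n)) = 0"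
        by simp
    qed simp
    then show ?thesis by simp
  qed
  \<comment> \<open>A closed convex set with nonempty interior is the closure of that interior, so
    every boundary point is a limit of interior ones.\<close>
  have clo: "closure (interior C) = C"
    using assms by (simp add: convex_closure_interior)
  have "F p - G p = 0" if "p \<in> C" for p
    by (rule continuous_constant_on_closure[of "interior C" "\<lambda>p. F p - G p"])
       (use cont clo that int in \<open>auto intro!: continuous_intros\<close>)
  moreover have "F p = G p" if "p \<notin> C" for p
    using F G that by (simp add: CM_tilde_def extensional_def)
  ultimately show "F = G" by (auto simp: fun_eq_iff)
qed

subsection \<open>Inversion of the Borel transform\<close>

theorem theorem4p1:
  fixes \<Gamma> :: "(real ^ 'n) set"
    and \<mu> :: "(real ^ 'n) measure"
    and \<Phi> :: "(real ^ 'n) \<times> real \<Rightarrow> real"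
  assumes "cone \<Gamma>" and "convex \<Gamma>" and "closed \<Gamma>" and "acute \<Gamma>" and "interior \<Gamma> \<noteq> {}"
    and "\<Phi> \<in> CM_H \<Gamma>"
    and "\<mu> \<in> finite_measures_on_dual \<Gamma>"
    and "\<Phi> = stieltjes_fantappie \<Gamma> \<mu>"
  shows "(\<exists>!F. F \<in> CM_tilde \<Gamma> \<and> borel_transform \<Gamma> F = \<Phi>) \<and>
    (\<forall>p\<in>interior \<Gamma>. \<forall>\<gamma>>0.
      ((\<lambda>T. 1 / (2 * of_real pi * \<i>) *
          contour_integral (linepath (Complex \<gamma> (- T)) (Complex \<gamma> T))
            (\<lambda>z. stieltjes_extension \<Gamma> \<mu> p z * exp z))
        \<longlongrightarrow> of_real (inverse_borel \<Gamma> \<Phi> p)) at_top)"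
proof -
  \<comment> \<open>Restricting the space turns set integrals over the dual cone into plain
    integrals.\<close>
  define \<nu> where "\<nu> = restrict_space \<mu> (dual_cone \<Gamma>)"
  have sets_\<mu> [measurable_cong]: "sets \<mu> = sets borel" and fin: "finite_measure \<mu>"
    using assms(7) by (auto simp: finite_measures_on_dual_def)
  have "dual_cone \<Gamma> = (\<Inter>x\<in>\<Gamma>. {y. 0 \<le> y \<bullet> x})" by (auto simp: dual_cone_def)
  then have "closed (dual_cone \<Gamma>)"
    by (auto intro!: closed_Collect_le continuous_intros)
  then have dual: "dual_cone \<Gamma> \<in> sets \<mu>" by (simp add: sets_\<mu>)
  have space_\<nu>: "space \<nu> = dual_cone \<Gamma>"
    using sets.sets_into_space[OF dual] by (auto simp: \<nu>_def space_restrict_space)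
  interpret measure_on_dual \<nu> \<Gamma>
  proof (intro measure_on_dual.intro measure_on_dual_axioms.intro)
    show "finite_measure \<nu>"
      unfolding \<nu>_def by (rule finite_measure_restrict_space[OF fin dual])
    show "(\<lambda>x. x) \<in> borel_measurable \<nu>"
      unfolding \<nu>_def by (intro measurable_restrict_space1) measurable
  qed (simp add: space_\<nu>)
  have set_int: "(LINT x:dual_cone \<Gamma>|\<mu>. f x) = (\<integral>x. f x \<partial>\<nu>)" for f :: "_ \<Rightarrow> 'c::{banach, second_countable_topology}"
    unfolding set_lebesgue_integral_def \<nu>_def using dual
    by (subst integral_restrict_space) auto
  \<comment> \<open>The restriction gives the Laplace transform the default value outside
    \<open>\<Gamma>\<close> that \<open>CM_tilde\<close> prescribes.\<close>
  define F where "F = restrict (laplace_moment []) \<Gamma>"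
  have F: "F \<in> CM_tilde \<Gamma>" unfolding F_def by (rule laplace_in_CM_tilde)
  have inj: "inj_on (borel_transform \<Gamma>) (CM_tilde \<Gamma>)"
    by (rule borel_transform_inj_on) fact+
  have BF: "borel_transform \<Gamma> F = \<Phi>"
    unfolding assms(8) borel_transform_def stieltjes_fantappie_def
  proof (rule restrict_ext, clarify)
    fix p and s :: real assume p: "p \<in> \<Gamma>" and "0 < s"
    have "t *\<^sub>R p \<in> \<Gamma>" if "0 \<le> t" for t using mem_cone[OF assms(1) p that] .
    then have "(LINT t:{0..}|lborel. F (t *\<^sub>R p) * exp (- t * s)) =
        (LINT t:{0..}|lborel. (\<integral>x. exp (- (t * (p \<bullet> x))) \<partial>\<nu>) * exp (- t * s))"
      by (intro set_lebesgue_integral_cong) (auto simp: F_def laplace_moment_def)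
    also have "\<dots> = (\<integral>x. 1 / (s + p \<bullet> x) \<partial>\<nu>)"
      by (rule Laplace_of_Laplace) (use p \<open>0 < s\<close> inner_nonneg in \<open>auto intro: finite_measure_axioms\<close>)
    finally show "(LINT t:{0..}|lborel. F (t *\<^sub>R p) * exp (- t * s)) =
        (LINT x:dual_cone \<Gamma>|\<mu>. 1 / (s + p \<bullet> x))"
      by (simp add: set_int)
  qed
  \<comment> \<open>By injectivity the preimage chosen by \<open>inv_into\<close> can only be
    \<open>F\<close>.\<close>
  have inv: "inverse_borel \<Gamma> \<Phi> = F"
    unfolding inverse_borel_def using inv_into_f_f[OF inj F] BF by simp
  show ?thesis
  proof (intro conjI ballI allI impI)
    show "\<exists>!F. F \<in> CM_tilde \<Gamma> \<and> borel_transform \<Gamma> F = \<Phi>"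
      using F BF inj by (auto simp: inj_on_def)
    fix p and \<gamma> :: real assume "p \<in> interior \<Gamma>" "0 < \<gamma>"
    then have p: "p \<in> \<Gamma>" using interior_subset by blast
    have "((\<lambda>T. 1 / (2 * of_real pi * \<i>) *
        contour_integral (linepath (Complex \<gamma> (- T)) (Complex \<gamma> T))
          (\<lambda>z. (\<integral>x. 1 / (z + of_real (p \<bullet> x)) \<partial>\<nu>) * exp z))
        \<longlongrightarrow> of_real (\<integral>x. exp (- (p \<bullet> x)) \<partial>\<nu>)) at_top"
      by (rule Bromwich_Stieltjes) (use p \<open>0 < \<gamma>\<close> inner_nonneg in \<open>auto intro: finite_measure_axioms\<close>)
    then show "((\<lambda>T. 1 / (2 * of_real pi * \<i>) *
        contour_integral (linepath (Complex \<gamma> (- T)) (Complex \<gamma> T))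
          (\<lambda>z. stieltjes_extension \<Gamma> \<mu> p z * exp z))
        \<longlongrightarrow> of_real (inverse_borel \<Gamma> \<Phi> p)) at_top"
      using p by (simp add: stieltjes_extension_def set_int inv F_def laplace_moment_def)
  qed
qed

end
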